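(* Let $\mathbf{A}\in\mathbb{R}^{m\times n}$, $\mathbf{b}\in\mathbb{R}^m$, $\mathbf{c},\mathbf{d}\in\mathbb{R}^n$, $\alpha,\beta\in\mathbb{R}$ be such that $X=\{\mathbf{x}\in\mathbb{R}^n \mid \mathbf{A}\mathbf{x}\le\mathbf{b},\ \mathbf{x}\ge\mathbf{0}_n\}$ is non-empty and bounded and $\mathbf{d}^T\mathbf{x}+\beta>0$ for all $\mathbf{x}\in X$. Let $\theta^*$ be the common optimal value of the linear programs (P) and (D) given in the context, and let $F_P^*$, $F_D^*$ be their sets of optimal solutions. Let $(p^*,\bar{\mathbf{x}}^{1*},\bar{\mathbf{x}}^{2*},\bar{\mathbf{u}}^{1*},\bar{\mathbf{u}}^{2*},w_P^{1*},w_P^{2*})$ be an optimal solution of the linear program $$\begin{aligned}\max\ & \sum_{j=1}^n \bar{x}_j^2+\sum_{i=1}^m\bar{u}_i^2+w_P^2\\ \text{s.t. } & \mathbf{A}(\bar{\mathbf{x}}^1+\bar{\mathbf{x}}^2)-\mathbf{b}p+\bar{\mathbf{u}}^1+\bar{\mathbf{u}}^2=\mathbf{0}_m,\\ & \mathbf{d}^T(\bar{\mathbf{x}}^1+\bar{\mathbf{x}}^2)+\beta p-(w_P^1+w_P^2)=0,\\ & \mathbf{c}^T(\bar{\mathbf{x}}^1+\bar{\mathbf{x}}^2)+\alpha p-\theta^*(w_P^1+w_P^2)=0,\\ & p\ge0,\ (\bar{\mathbf{x}}^1,\bar{\mathbf{u}}^1,w_P^1)\ge\mathbf{0}_{m+n+1},\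 \mathbf{0}_{m+n+1}\le(\bar{\mathbf{x}}^2,\bar{\mathbf{u}}^2,w_P^2)\le\mathbf{1}_{m+n+1},\end{aligned}$$ and let $(q^*,\mathbf{y}^{1*},\mathbf{y}^{2*},\mathbf{v}^{1*},\mathbf{v}^{2*},w_D^{1*},w_D^{2*})$ be an optimal solution of the linear program (with $q\in\mathbb{R}$ free) $$\begin{aligned}\max\ & \sum_{i=1}^m y_i^2+\sum_{j=1}^n v_j^2+w_D^2\\ \text{s.t. } & \mathbf{A}^T(\mathbf{y}^1+\mathbf{y}^2)+\mathbf{d}q-(\mathbf{v}^1+\mathbf{v}^2)-\mathbf{c}(w_D^1+w_D^2)=\mathbf{0}_n,\\ & -\mathbf{b}^T(\mathbf{y}^1+\mathbf{y}^2)+\beta q-\alpha(w_D^1+w_D^2)=0,\\ & q-\theta^*(w_D^1+w_D^2)=0,\\ & (\mathbf{y}^1,\mathbf{v}^1,w_D^1)\ge\mathbf{0}_{m+n+1},\ \mathbf{0}_{m+n+1}\le(\mathbf{y}^2,\mathbf{v}^2,w_D^2)\le\mathbf{1}_{m+n+1}.\end{aligned}$$ Then the following vectors are well defined (the denominators are non-zero) and satisfy $$(\bar{\mathbf{x}}^*,t^*,\bar{\mathbf{u}}^* ):=\frac{1}{w_P^{1*}+w_P^{2*}}\left(\bar{\mathbf{x}}^{1*}+\bar{\mathbf{x}}^{2*},\ p^*,\ \bar{\mathbf{u}}^{1*}+\bar{\mathbf{u}}^{2*}\right)\in ri(F_P^* ),$$ $$(\mathbf{y}^*,z^*,\mathbf{v}^*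 ):=\frac{1}{w_D^{1*}+w_D^{2*}}\left(\mathbf{y}^{1*}+\mathbf{y}^{2*},\ q^*,\ \mathbf{v}^{1*}+\mathbf{v}^{2*}\right)\in ri(F_D^* ),$$ and consequently $\left(\frac{1}{t^*}(\bar{\mathbf{x}}^*,\bar{\mathbf{u}}^* ),(\mathbf{y}^*,z^*,\mathbf{v}^* )\right)$ is a strict complementary solution for the linear fractional program $\max\{(\mathbf{c}^T\mathbf{x}+\alpha)/(\mathbf{d}^T\mathbf{x}+\beta)\mid \mathbf{x}\in X\}$ and its dual $\min\{z \mid \mathbf{A}^T\mathbf{y}+\mathbf{d}z\ge\mathbf{c},\ -\mathbf{b}^T\mathbf{y}+\beta z=\alpha,\ \mathbf{y}\ge\mathbf{0}_m\}$.
   Context: Vector inequalities are componentwise; $\mathbf{0}_k,\mathbf{1}_k\in\mathbb{R}^k$ are the all-zeros and all-ones vectors; $ri(\cdot)$ is the relative interior of a convex set. The superscripts $1,2$ on variables are labels of distinct variables, not powers: $\bar{x}_j^2$ is the $j$-th component of the vector $\bar{\mathbf{x}}^2$, and similarly for the other variables. Program (P), with variables $(\bar{\mathbf{x}},t,\bar{\mathbf{u}})\in\mathbb{R}^n\times\mathbb{R}\times\mathbb{R}^m$: $\max\ \mathbf{c}^T\bar{\mathbf{x}}+\alpha t$ subject to $\mathbf{A}\bar{\mathbf{x}}+\bar{\mathbf{u}}=\mathbf{b}t$, $\mathbf{d}^T\bar{\mathbf{x}}+\beta t=1$, $\bar{\mathbf{x}}\ge\mathbf{0}_n$, $t\ge0$,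 $\bar{\mathbf{u}}\ge\mathbf{0}_m$. Program (D), with variables $(\mathbf{y},z,\mathbf{v})\in\mathbb{R}^m\times\mathbb{R}\times\mathbb{R}^n$: $\min\ z$ subject to $\mathbf{A}^T\mathbf{y}+\mathbf{d}z-\mathbf{v}=\mathbf{c}$, $-\mathbf{b}^T\mathbf{y}+\beta z=\alpha$, $\mathbf{y}\ge\mathbf{0}_m$, $\mathbf{v}\ge\mathbf{0}_n$ ($z$ free in sign). A feasible primal-dual solution is a pair $\left((\mathbf{x}^*,\mathbf{u}^* ),(\mathbf{y}^*,z^*,\mathbf{v}^* )\right)$ where $\mathbf{x}^*$ is feasible for the linear fractional program, $(\mathbf{y}^*,z^* )$ is feasible for its dual, and $\mathbf{u}^*=\mathbf{b}-\mathbf{A}\mathbf{x}^*$, $\mathbf{v}^*=\mathbf{A}^T\mathbf{y}^*+\mathbf{d}z^*-\mathbf{c}$. It is called a strict complementary solution if $\mathbf{x}^{*T}\mathbf{v}^*=0$, $\mathbf{y}^{*T}\mathbf{u}^*=0$, $\mathbf{x}^*+\mathbf{v}^*>\mathbf{0}_n$ and $\mathbf{y}^*+\mathbf{u}^*>\mathbf{0}_m$, the strict inequalities holding in every component. *)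

theory Defs
  imports "HOL-Analysis.Analysis"
begin

(* Throughout, "\<le>" on real^'k is the componentwise order of Finite_Cartesian_Product, and the
   vectors 0 and 1 of real^'k have all components equal to 0 and 1.  The order "<" on real^'k is
   not componentwise strictness, so strict vector inequalities are written out. *)

text \<open>The linear fractional program
  \<open>max {(c \<bullet> x + \<alpha>) / (d \<bullet> x + \<beta>) | A x \<le> b, x \<ge> 0}\<close> and its dual
  \<open>min {z | A\<^sup>T y + d z \<ge> c, - (b \<bullet> y) + \<beta> z = \<alpha>, y \<ge> 0}\<close>.\<close>

definition lfp_feasible :: "real^'n^'m \<Rightarrow> real^'m \<Rightarrow> (real^'n) set" where
  "lfp_feasible A b = {x. A *v x \<le> b \<and> 0 \<le> x}"

definition lfp_dual_feasible ::
  "real^'n^'m \<Rightarrow> real^'m \<Rightarrow> real^'n \<Rightarrow> real^'n \<Rightarrow> real \<Rightarrow> real \<Rightarrow> ((real^'m) \<times> real) set" where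
  "lfp_dual_feasible A b c d \<alpha> \<beta> =
     {(y, z). c \<le> transpose A *v y + z *\<^sub>R d \<and> - (b \<bullet> y) + \<beta> * z = \<alpha> \<and> 0 \<le> y}"

definition strict_complementary_solution ::
  "real^'n^'m \<Rightarrow> real^'m \<Rightarrow> real^'n \<Rightarrow> real^'n \<Rightarrow> real \<Rightarrow> real
    \<Rightarrow> ((real^'n) \<times> (real^'m)) \<times> ((real^'m) \<times> real \<times> (real^'n)) \<Rightarrow> bool" where
  "strict_complementary_solution A b c d \<alpha> \<beta> = (\<lambda>((x, u), (y, z, v)).
     x \<in> lfp_feasible A b \<and>
     (y, z) \<in> lfp_dual_feasible A b c d \<alpha> \<beta> \<and>
     u = b - A *v x \<and>
     v = transpose A *v y + z *\<^sub>R d - c \<and>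
     x \<bullet> v = 0 \<and>
     y \<bullet> u = 0 \<and>
     (\<forall>j. (x + v) $ j > 0) \<and>
     (\<forall>i. (y + u) $ i > 0))"

text \<open>Programs (P) and (D).\<close>

definition P_feasible ::
  "real^'n^'m \<Rightarrow> real^'m \<Rightarrow> real^'n \<Rightarrow> real \<Rightarrow> ((real^'n) \<times> real \<times> (real^'m)) set" where
  "P_feasible A b d \<beta> =
     {(x, t, u). A *v x + u = t *\<^sub>R b \<and> d \<bullet> x + \<beta> * t = 1 \<and> 0 \<le> x \<and> 0 \<le> t \<and> 0 \<le> u}"

definition P_objective :: "real^'n \<Rightarrow> real \<Rightarrow> (real^'n) \<times> real \<times> (real^'m) \<Rightarrow> real" where
  "P_objective c \<alpha> = (\<lambda>(x, t, u). c \<bullet> x + \<alpha> * t)"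

definition P_value ::
  "real^'n^'m \<Rightarrow> real^'m \<Rightarrow> real^'n \<Rightarrow> real^'n \<Rightarrow> real \<Rightarrow> real \<Rightarrow> real" where
  "P_value A b c d \<alpha> \<beta> = Sup (P_objective c \<alpha> ` P_feasible A b d \<beta>)"

definition P_optimal ::
  "real^'n^'m \<Rightarrow> real^'m \<Rightarrow> real^'n \<Rightarrow> real^'n \<Rightarrow> real \<Rightarrow> real
    \<Rightarrow> ((real^'n) \<times> real \<times> (real^'m)) set" where
  "P_optimal A b c d \<alpha> \<beta> =
     {s. is_arg_max (P_objective c \<alpha>) (\<lambda>s. s \<in> P_feasible A b d \<beta>) s}"

definition D_feasible ::
  "real^'n^'m \<Rightarrow> real^'m \<Rightarrow> real^'n \<Rightarrow> real^'n \<Rightarrow> real \<Rightarrow> real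
    \<Rightarrow> ((real^'m) \<times> real \<times> (real^'n)) set" where
  "D_feasible A b c d \<alpha> \<beta> =
     {(y, z, v). transpose A *v y + z *\<^sub>R d - v = c \<and> - (b \<bullet> y) + \<beta> * z = \<alpha> \<and> 0 \<le> y \<and> 0 \<le> v}"

definition D_objective :: "(real^'m) \<times> real \<times> (real^'n) \<Rightarrow> real" where
  "D_objective = (\<lambda>(y, z, v). z)"

definition D_value ::
  "real^'n^'m \<Rightarrow> real^'m \<Rightarrow> real^'n \<Rightarrow> real^'n \<Rightarrow> real \<Rightarrow> real \<Rightarrow> real" where
  "D_value A b c d \<alpha> \<beta> = Inf (D_objective ` D_feasible A b c d \<alpha> \<beta>)"

definition D_optimal ::
  "real^'n^'m \<Rightarrow> real^'m \<Rightarrow> real^'n \<Rightarrow> real^'n \<Rightarrow> real \<Rightarrow> real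
    \<Rightarrow> ((real^'m) \<times> real \<times> (real^'n)) set" where
  "D_optimal A b c d \<alpha> \<beta> =
     {s. is_arg_min D_objective (\<lambda>s. s \<in> D_feasible A b c d \<alpha> \<beta>) s}"

text \<open>The two auxiliary linear programs, with variables \<open>(p, x1, x2, u1, u2, w1, w2)\<close> and
  \<open>(q, y1, y2, v1, v2, w1, w2)\<close>.\<close>

definition aux_P_feasible ::
  "real^'n^'m \<Rightarrow> real^'m \<Rightarrow> real^'n \<Rightarrow> real^'n \<Rightarrow> real \<Rightarrow> real \<Rightarrow> real
    \<Rightarrow> (real \<times> (real^'n) \<times> (real^'n) \<times> (real^'m) \<times> (real^'m) \<times> real \<times> real) set" where
  "aux_P_feasible A b c d \<alpha> \<beta> \<theta> = {(p, x1, x2, u1, u2, w1, w2).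
     A *v (x1 + x2) - p *\<^sub>R b + u1 + u2 = 0 \<and>
     d \<bullet> (x1 + x2) + \<beta> * p - (w1 + w2) = 0 \<and>
     c \<bullet> (x1 + x2) + \<alpha> * p - \<theta> * (w1 + w2) = 0 \<and>
     0 \<le> p \<and>
     0 \<le> x1 \<and> 0 \<le> u1 \<and> 0 \<le> w1 \<and>
     0 \<le> x2 \<and> 0 \<le> u2 \<and> 0 \<le> w2 \<and>
     x2 \<le> 1 \<and> u2 \<le> 1 \<and> w2 \<le> 1}"

definition aux_P_objective ::
  "real \<times> (real^'n) \<times> (real^'n) \<times> (real^'m) \<times> (real^'m) \<times> real \<times> real \<Rightarrow> real" where
  "aux_P_objective = (\<lambda>(p, x1, x2, u1, u2, w1, w2).
     (\<Sum>j\<in>UNIV. x2 $ j) + (\<Sum>i\<in>UNIV. u2 $ i) + w2)"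

definition aux_D_feasible ::
  "real^'n^'m \<Rightarrow> real^'m \<Rightarrow> real^'n \<Rightarrow> real^'n \<Rightarrow> real \<Rightarrow> real \<Rightarrow> real
    \<Rightarrow> (real \<times> (real^'m) \<times> (real^'m) \<times> (real^'n) \<times> (real^'n) \<times> real \<times> real) set" where
  "aux_D_feasible A b c d \<alpha> \<beta> \<theta> = {(q, y1, y2, v1, v2, w1, w2).
     transpose A *v (y1 + y2) + q *\<^sub>R d - (v1 + v2) - (w1 + w2) *\<^sub>R c = 0 \<and>
     - (b \<bullet> (y1 + y2)) + \<beta> * q - \<alpha> * (w1 + w2) = 0 \<and>
     q - \<theta> * (w1 + w2) = 0 \<and>
     0 \<le> y1 \<and> 0 \<le> v1 \<and> 0 \<le> w1 \<and>
     0 \<le> y2 \<and> 0 \<le> v2 \<and> 0 \<le> w2 \<and>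
     y2 \<le> 1 \<and> v2 \<le> 1 \<and> w2 \<le> 1}"

definition aux_D_objective ::
  "real \<times> (real^'m) \<times> (real^'m) \<times> (real^'n) \<times> (real^'n) \<times> real \<times> real \<Rightarrow> real" where
  "aux_D_objective = (\<lambda>(q, y1, y2, v1, v2, w1, w2).
     (\<Sum>i\<in>UNIV. y2 $ i) + (\<Sum>j\<in>UNIV. v2 $ j) + w2)"

end

theory Submission
  imports Defs
begin

text \<open>Tucker's theorem: a subspace and its orthogonal complement contain nonnegative vectors whose sum
  is strictly positive. Applied to the homogenisation of (P) and (D), with one slack for the
  normalisation and one for the objective, it yields at once strong duality and a strictly
  complementary optimal pair: nonemptiness and boundedness of \<open>X\<close> exclude the degenerate case in which
  the homogenising variables vanish.

  Any element of the homogeneous cone may be added to a feasible point of an auxiliary program, and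
  the summands \<open>x1, x2\<close> redistributed as \<open>x2' = min 1 (x1 + x2 + x0)\<close>. At an optimum this cannot
  increase \<open>x2\<close>, so an optimum has maximal support in the cone. The optimal faces are cut out by
  equations and sign constraints, so their points of maximal support are relatively interior.\<close>

section \<open>Tucker's theorem\<close>

text \<open>Farkas' lemma for a subspace. The hypothesis keeps \<open>- i\<close> out of the
  nonnegative orthant plus \<open>L\<close>; the normal of a separating hyperplane is nonnegative on
  the orthant, vanishes on \<open>L\<close> and is positive at \<open>i\<close>.\<close>

lemma farkas_subspace:
  fixes L :: "'a::euclidean_space set"
  assumes L: "subspace L" and i: "i \<in> Basis"
    and none: "\<And>x. x \<in> L \<Longrightarrow> \<forall>k\<in>Basis. 0 \<le> x \<bullet> k \<Longrightarrow> x \<bullet> i \<le> 0"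
  shows "\<exists>y. (\<forall>x\<in>L. x \<bullet> y = 0) \<and> (\<forall>k\<in>Basis. 0 \<le> y \<bullet> k) \<and> 0 < y \<bullet> i"
proof -
  obtain B where B: "B \<subseteq> L" "L \<subseteq> span B" "independent B"
    by (rule basis_exists)
  have "finite B"
    using B(3) by (rule finiteI_independent)
  \<comment> \<open>\<open>C\<close> is finitely generated, hence closed, as the separation
    requires; \<open>K\<close>, the orthant plus \<open>L\<close>, gives its elements an explicit
    form.\<close>
  define C where "C = convex_cone hull (Basis \<union> B \<union> uminus ` B)"
  define K where "K = (\<Union>o'\<in>{x. \<forall>k\<in>Basis. 0 \<le> x \<bullet> k}. \<Union>l\<in>L. {o' + l})"
  have "convex_cone {x::'a. \<forall>k\<in>Basis. 0 \<le> x \<bullet> k}"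
    by (simp add: convex_cone_iff inner_simps)
  moreover have "convex_cone L"
    using L by (simp add: convex_cone_iff subspace_def)
  ultimately have "convex_cone K"
    unfolding K_def by (rule convex_cone_sums)
  moreover have "Basis \<union> B \<union> uminus ` B \<subseteq> K"
  proof -
    have K_iff: "x \<in> K \<longleftrightarrow> (\<exists>o' l. (\<forall>k\<in>Basis. 0 \<le> o' \<bullet> k) \<and> l \<in> L \<and> x = o' + l)" for x
      by (auto simp: K_def)
    have "x \<in> K" if "x \<in> Basis" for x
    proof -
      have "\<forall>k\<in>Basis. 0 \<le> x \<bullet> k"
        using that by (simp add: inner_Basis)
      then show ?thesis
        using subspace_0[OF L] unfolding K_iff by (intro exI[of _ x] exI[of _ 0]) simp
    qed
    moreover have "x \<in> K" if "x \<in> L" for x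
      unfolding K_iff using that by (intro exI[of _ 0] exI[of _ x]) simp
    ultimately show ?thesis
      using B(1) subspace_neg[OF L] by blast
  qed
  ultimately have CK: "C \<subseteq> K"
    unfolding C_def by (metis hull_minimal)
  have "- i \<notin> C"
  proof
    assume "- i \<in> C"
    then obtain o' l where o': "\<forall>k\<in>Basis. 0 \<le> o' \<bullet> k" and l: "l \<in> L" and eq: "- i = o' + l"
      using CK by (auto simp: K_def)
    have "- l = o' + i"
      by (simp add: eq_diff_eq[THEN iffD2, OF eq[symmetric]])
    moreover have "- l \<in> L"
      using l subspace_neg[OF L] by blast
    ultimately have "o' + i \<in> L"
      by simp
    moreover have "\<forall>k\<in>Basis. 0 \<le> (o' + i) \<bullet> k"
      using o' i by (auto simp: inner_simps inner_Basis)
    ultimately have "(o' + i) \<bullet> i \<le> 0"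
      by (rule none)
    moreover have "0 \<le> o' \<bullet> i"
      using o' i by blast
    ultimately show False
      using i by (simp add: inner_simps)
  qed
  moreover have "closed C" "convex C"
    using \<open>finite B\<close> by (simp_all add: C_def closed_convex_cone_hull convex_convex_cone_hull)
  ultimately obtain y \<delta> where y: "y \<bullet> (- i) < \<delta>" "\<And>x. x \<in> C \<Longrightarrow> \<delta> < y \<bullet> x"
    using separating_hyperplane_closed_point by metis
  have "\<delta> < 0"
    using y(2)[of 0] by (simp add: C_def convex_cone_hull_contains_0)
  \<comment> \<open>\<open>C\<close> is stable under nonnegative scaling, so a negative value could
    be scaled to exactly \<open>\<delta>\<close>, against the strict bound.\<close>
  have nonneg: "0 \<le> y \<bullet> x" if "x \<in> C" for x
  proof (rule ccontr)
    assume neg: "\<not> 0 \<le> y \<bullet> x"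
    then have "(\<delta> / (y \<bullet> x)) *\<^sub>R x \<in> C"
      using that \<open>\<delta> < 0\<close> unfolding C_def by (intro convex_cone_hull_mul) (simp_all add: divide_nonpos_neg)
    then show False
      using y(2) neg by fastforce
  qed
  have sub: "Basis \<union> B \<union> uminus ` B \<subseteq> C"
    unfolding C_def by (rule hull_subset)
  have "\<forall>k\<in>Basis. 0 \<le> y \<bullet> k"
    using nonneg sub by blast
  moreover have "0 < y \<bullet> i"
    using y(1) \<open>\<delta> < 0\<close> by simp
  moreover have "\<forall>x\<in>L. x \<bullet> y = 0"
  proof -
    \<comment> \<open>Both signs of each generator of \<open>L\<close> lie in \<open>C\<close>, so
      nonnegativity on \<open>C\<close> becomes orthogonality.\<close>
    have "orthogonal y x" if "x \<in> B" for x
    proof -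
      have "x \<in> C" "- x \<in> C"
        using that sub by blast+
      then show ?thesis
        using nonneg[of x] nonneg[of "- x"] by (simp add: orthogonal_def)
    qed
    then have "orthogonal y x" if "x \<in> L" for x
      using orthogonal_to_span[of x B y] that B(2) by blast
    then show ?thesis
      by (simp add: orthogonal_def inner_commute)
  qed
  ultimately show ?thesis
    by blast
qed

text \<open>Each coordinate is served by one side: if no nonnegative vector of \<open>L\<close> is
  positive at \<open>i\<close>, Farkas supplies one in the orthogonal complement, and zero fills the
  other slot. Summing these pairs over \<open>Basis\<close> keeps all signs and makes every
  coordinate positive.\<close>

lemma subspace_strict_complementarity:
  fixes L :: "'a::euclidean_space set"
  assumes L: "subspace L"
  obtains x y where "x \<in> L" "\<And>l. l \<in> L \<Longrightarrow> l \<bullet> y = 0"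
    "\<And>i. i \<in> Basis \<Longrightarrow> 0 \<le> x \<bullet> i" "\<And>i. i \<in> Basis \<Longrightarrow> 0 \<le> y \<bullet> i"
    "\<And>i. i \<in> Basis \<Longrightarrow> 0 < x \<bullet> i + y \<bullet> i"
proof -
  have "\<exists>x y. x \<in> L \<and> (\<forall>l\<in>L. l \<bullet> y = 0) \<and> (\<forall>k\<in>Basis. 0 \<le> x \<bullet> k) \<and> (\<forall>k\<in>Basis. 0 \<le> y \<bullet> k) \<and>
      0 < x \<bullet> i + y \<bullet> i" if i: "i \<in> Basis" for i
  proof (cases "\<exists>x\<in>L. (\<forall>k\<in>Basis. 0 \<le> x \<bullet> k) \<and> 0 < x \<bullet> i")
    case True
    then show ?thesis
      by (metis add.right_neutral inner_zero_left inner_zero_right order_refl)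
  next
    case False
    then have "\<exists>y. (\<forall>x\<in>L. x \<bullet> y = 0) \<and> (\<forall>k\<in>Basis. 0 \<le> y \<bullet> k) \<and> 0 < y \<bullet> i"
      by (intro farkas_subspace[OF L i]) (meson not_le)
    then show ?thesis
      using subspace_0[OF L] by (metis add.left_neutral inner_zero_left order_refl)
  qed
  then have "\<forall>i\<in>Basis. \<exists>x y. x \<in> L \<and> (\<forall>l\<in>L. l \<bullet> y = 0) \<and>
      (\<forall>k\<in>Basis. 0 \<le> x \<bullet> k) \<and> (\<forall>k\<in>Basis. 0 \<le> y \<bullet> k) \<and> 0 < x \<bullet> i + y \<bullet> i"
    by blast
  then obtain f g where "\<forall>i\<in>Basis. f i \<in> L \<and> (\<forall>l\<in>L. l \<bullet> g i = 0) \<and>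
      (\<forall>k\<in>Basis. 0 \<le> f i \<bullet> k) \<and> (\<forall>k\<in>Basis. 0 \<le> g i \<bullet> k) \<and> 0 < f i \<bullet> i + g i \<bullet> i"
    unfolding bchoice_iff by blast
  then have fg: "\<And>i. i \<in> Basis \<Longrightarrow> f i \<in> L"
    "\<And>i l. i \<in> Basis \<Longrightarrow> l \<in> L \<Longrightarrow> l \<bullet> g i = 0"
    "\<And>i k. i \<in> Basis \<Longrightarrow> k \<in> Basis \<Longrightarrow> 0 \<le> f i \<bullet> k"
    "\<And>i k. i \<in> Basis \<Longrightarrow> k \<in> Basis \<Longrightarrow> 0 \<le> g i \<bullet> k"
    "\<And>i. i \<in> Basis \<Longrightarrow> 0 < f i \<bullet> i + g i \<bullet> i"
    by blast+
  show thesis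
  proof
    show "sum f Basis \<in> L"
      using fg(1) by (rule subspace_sum[OF L])
    show "l \<bullet> sum g Basis = 0" if "l \<in> L" for l
      using fg(2) that by (simp add: inner_sum_right)
    show "0 \<le> sum f Basis \<bullet> i" "0 \<le> sum g Basis \<bullet> i" if "i \<in> Basis" for i
      using fg(3,4) that by (simp_all add: inner_sum_left sum_nonneg)
    show "0 < sum f Basis \<bullet> i + sum g Basis \<bullet> i" if "i \<in> Basis" for i
    proof -
      have "f i \<bullet> i \<le> sum f Basis \<bullet> i" "g i \<bullet> i \<le> sum g Basis \<bullet> i"
        unfolding inner_sum_left using fg(3,4) that by (auto intro!: member_le_sum)
      then show ?thesis
        using fg(5)[OF that] by linarith
    qed
  qed
qed

section \<open>Strong duality with strict complementarity\<close>

lemma inner_nonneg_vec: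
  fixes x y :: "real^'k"
  shows "0 \<le> x \<Longrightarrow> 0 \<le> y \<Longrightarrow> 0 \<le> x \<bullet> y"
  unfolding inner_vec_def less_eq_vec_def by (intro sum_nonneg) simp

lemma inner_zero_vec:
  fixes x y :: "real^'k"
  assumes "0 \<le> x" "0 \<le> y" "x \<bullet> y = 0"
  shows "x $ i = 0 \<or> y $ i = 0"
proof -
  have "\<forall>i\<in>UNIV. x $ i * y $ i = 0"
    using assms by (intro sum_nonneg_eq_0_iff[THEN iffD1]) (simp_all add: inner_vec_def less_eq_vec_def)
  then show ?thesis
    by simp
qed

lemma inner_transpose_mult:
  fixes A :: "real^'n^'m"
  shows "(transpose A *v y) \<bullet> x = y \<bullet> (A *v x)"
  by (simp only: transpose_matrix_vector dot_lmul_matrix)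

text \<open>Eliminating \<open>c\<close>, \<open>\<alpha>\<close> and \<open>u\<close> through the
  constraints cancels everything except the two complementarity products. Weak duality and
  complementary slackness both follow, since these products are nonnegative.\<close>

lemma duality_gap:
  assumes "(x, t, u) \<in> P_feasible A b d \<beta>" "(y, z, v) \<in> D_feasible A b c d \<alpha> \<beta>"
  shows "z - (c \<bullet> x + \<alpha> * t) = x \<bullet> v + y \<bullet> u"
proof -
  have u: "u = t *\<^sub>R b - A *v x" and one: "d \<bullet> x + \<beta> * t = 1"
    and c: "c = transpose A *v y + z *\<^sub>R d - v" and \<alpha>: "\<alpha> = - (b \<bullet> y) + \<beta> * z"
    using assms by (auto simp: P_feasible_def D_feasible_def algebra_simps)
  have "c \<bullet> x = y \<bullet> (A *v x) + z * (d \<bullet> x) - v \<bullet> x"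
    unfolding c inner_diff_left inner_add_left inner_transpose_mult by simp
  moreover have "y \<bullet> u = t * (b \<bullet> y) - y \<bullet> (A *v x)"
    unfolding u inner_diff_right by (simp add: inner_commute)
  \<comment> \<open>Multiplying the normalisation by \<open>z\<close> splits the dual objective into
    terms that cancel against the other two identities.\<close>
  moreover have "z = z * (d \<bullet> x) + z * \<beta> * t"
    using arg_cong[OF one, of "(*) z"] by (simp add: algebra_simps)
  ultimately show ?thesis
    by (simp add: \<alpha> inner_commute[of x v] algebra_simps)
qed

section \<open>Charnes-Cooper correspondence between the polyhedron and (P)\<close>

lemma lfp_feasible_recession:
  fixes A :: "real^'n^'m"
  assumes "lfp_feasible A b \<noteq> {}" "bounded (lfp_feasible A b)" "A *v x \<le> 0" "0 \<le> x"
  shows "x = 0"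
proof (rule ccontr)
  assume "x \<noteq> 0"
  obtain \<xi> where \<xi>: "\<xi> \<in> lfp_feasible A b"
    using assms(1) by blast
  obtain M where M: "\<And>\<eta>. \<eta> \<in> lfp_feasible A b \<Longrightarrow> norm \<eta> \<le> M"
    using assms(2) by (auto simp: bounded_iff)
  \<comment> \<open>A nonzero \<open>x\<close> would be a recession direction of a bounded set: with
    this step length \<open>\<xi> + k *\<^sub>R x\<close> has norm at least
    \<open>M + 1\<close>.\<close>
  define k where "k = (M + norm \<xi> + 1) / norm x"
  have "0 \<le> M"
    using M[OF \<xi>] norm_ge_zero order_trans by blast
  then have "0 \<le> k"
    by (simp add: k_def)
  have "\<xi> + k *\<^sub>R x \<in> lfp_feasible A b"
  proof -
    have "A *v (\<xi> + k *\<^sub>R x) = A *v \<xi> + k *\<^sub>R (A *v x)"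
      by (simp add: matrix_vector_right_distrib matrix_vector_mult_scaleR)
    also have "\<dots> \<le> b"
      using \<xi> assms(3) \<open>0 \<le> k\<close>
      by (auto simp: lfp_feasible_def less_eq_vec_def)
        (metis add_mono_thms_linordered_semiring(1) add.right_neutral mult_nonneg_nonpos)
    finally show ?thesis
      using \<xi> assms(4) \<open>0 \<le> k\<close> by (auto simp: lfp_feasible_def less_eq_vec_def)
  qed
  then have "norm (\<xi> + k *\<^sub>R x) \<le> M"
    by (rule M)
  moreover have "norm (k *\<^sub>R x) = M + norm \<xi> + 1"
    using \<open>x \<noteq> 0\<close> \<open>0 \<le> M\<close> by (simp add: k_def)
  ultimately show False
    using norm_triangle_ineq2[of "k *\<^sub>R x" "- \<xi>"] by (simp add: add.commute)
qed

text \<open>For \<open>t = 0\<close> the vector \<open>x\<close> is a recession direction of the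
  bounded polyhedron, so \<open>x\<close> and then \<open>u\<close> vanish; for \<open>t > 0\<close>
  division by \<open>t\<close> lands in the polyhedron.\<close>

lemma homogenised_feasible_cases:
  fixes A :: "real^'n^'m"
  assumes "lfp_feasible A b \<noteq> {}" "bounded (lfp_feasible A b)"
    and eq: "A *v x + u = t *\<^sub>R b" and "0 \<le> x" "0 \<le> t" "0 \<le> u"
  obtains "t = 0" "x = 0" "u = 0" | "0 < t" "(1 / t) *\<^sub>R x \<in> lfp_feasible A b"
proof (cases "t = 0")
  case True
  then have "A *v x = - u"
    using eq by (simp add: add_eq_0_iff2)
  then have "x = 0"
    using lfp_feasible_recession assms by (metis neg_le_0_iff_le)
  then show thesis
    using True eq that(1) by simp
next
  case False
  have "A *v ((1 / t) *\<^sub>R x) = b - (1 / t) *\<^sub>R u"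
  proof -
    have "A *v x = t *\<^sub>R b - u"
      using eq by (simp add: algebra_simps)
    then show ?thesis
      using False by (simp add: matrix_vector_mult_scaleR scaleR_diff_right)
  qed
  then have "(1 / t) *\<^sub>R x \<in> lfp_feasible A b"
    using assms by (auto simp: lfp_feasible_def less_eq_vec_def)
  then show thesis
    using False \<open>0 \<le> t\<close> that(2) by simp
qed

text \<open>The normalisation excludes the degenerate case, where its left-hand side would be 0, so
  the inverse Charnes-Cooper substitution is always available.\<close>

lemma P_feasible_pos:
  assumes "lfp_feasible A b \<noteq> {}" "bounded (lfp_feasible A b)" "(x, t, u) \<in> P_feasible A b d \<beta>"
  shows "0 < t" "(1 / t) *\<^sub>R x \<in> lfp_feasible A b"
proof -
  have f: "A *v x + u = t *\<^sub>R b" "d \<bullet> x + \<beta> * t = 1" "0 \<le> x" "0 \<le> t" "0 \<le> u"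
    using assms(3) by (auto simp: P_feasible_def)
  have "0 < t \<and> (1 / t) *\<^sub>R x \<in> lfp_feasible A b"
    by (rule homogenised_feasible_cases[OF assms(1,2) f(1,3-5)]) (use f(2) in auto)
  then show "0 < t" "(1 / t) *\<^sub>R x \<in> lfp_feasible A b"
    by auto
qed

lemma closed_lfp_feasible: "closed (lfp_feasible A b)"
proof -
  have "lfp_feasible A b =
      (\<Inter>i. {x. (A *v x) $ i \<le> b $ i}) \<inter> (\<Inter>j. {x. 0 \<le> x $ j})"
    by (auto simp: lfp_feasible_def less_eq_vec_def)
  also have "closed \<dots>"
    by (intro closed_Int closed_INT closed_Collect_le continuous_intros ballI
        matrix_vector_mult_linear_continuous_on)
  finally show ?thesis .
qed

text \<open>The supremum is informative only once the values are known to be bounded above. The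
  inverse Charnes-Cooper substitution turns them into values of the fractional objective, which is
  continuous on a compact set.\<close>

lemma P_objective_le_value:
  fixes A :: "real^'n^'m"
  assumes ne: "lfp_feasible A b \<noteq> {}" and bd: "bounded (lfp_feasible A b)"
    and pos: "\<And>\<xi>. \<xi> \<in> lfp_feasible A b \<Longrightarrow> d \<bullet> \<xi> + \<beta> > 0"
    and s: "s \<in> P_feasible A b d \<beta>"
  shows "P_objective c \<alpha> s \<le> P_value A b c d \<alpha> \<beta>"
proof -
  have "compact (lfp_feasible A b)"
    using bd closed_lfp_feasible compact_eq_bounded_closed by blast
  moreover have "continuous_on (lfp_feasible A b) (\<lambda>\<xi>. (c \<bullet> \<xi> + \<alpha>) / (d \<bullet> \<xi> + \<beta>))"
    by (intro continuous_intros) (use pos in force)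
  ultimately obtain \<eta> where \<eta>: "\<And>\<xi>. \<xi> \<in> lfp_feasible A b \<Longrightarrow>
      (c \<bullet> \<xi> + \<alpha>) / (d \<bullet> \<xi> + \<beta>) \<le> (c \<bullet> \<eta> + \<alpha>) / (d \<bullet> \<eta> + \<beta>)"
    using continuous_attains_sup[OF _ ne] by blast
  have "bdd_above (P_objective c \<alpha> ` P_feasible A b d \<beta>)"
  proof (rule bdd_aboveI2)
    fix s assume "s \<in> P_feasible A b d \<beta>"
    then obtain x t u where s: "s = (x, t, u)" and f: "(x, t, u) \<in> P_feasible A b d \<beta>"
      by (cases s) auto
    have t: "0 < t" and \<xi>: "(1 / t) *\<^sub>R x \<in> lfp_feasible A b"
      using P_feasible_pos[OF ne bd f] .
    have "d \<bullet> x + \<beta> * t = 1"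
      using f by (simp add: P_feasible_def)
    \<comment> \<open>At \<open>x / t\<close> the denominator is \<open>1 / t\<close>, so the ratio
      there equals the linear objective at \<open>(x, t, u)\<close>.\<close>
    then have "d \<bullet> ((1 / t) *\<^sub>R x) + \<beta> = 1 / t"
      using t by (simp add: field_simps)
    then have "P_objective c \<alpha> s =
        (c \<bullet> ((1 / t) *\<^sub>R x) + \<alpha>) / (d \<bullet> ((1 / t) *\<^sub>R x) + \<beta>)"
      using t by (simp add: s P_objective_def field_simps)
    then show "P_objective c \<alpha> s \<le> (c \<bullet> \<eta> + \<alpha>) / (d \<bullet> \<eta> + \<beta>)"
      using \<eta>[OF \<xi>] by simp
  qed
  then show ?thesis
    unfolding P_value_def using s by (intro cSUP_upper)
qed

lemma P_feasible_nonempty: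
  fixes A :: "real^'n^'m"
  assumes "\<xi> \<in> lfp_feasible A b" "d \<bullet> \<xi> + \<beta> > 0"
  shows "P_feasible A b d \<beta> \<noteq> {}"
proof -
  \<comment> \<open>Charnes-Cooper scaling: this factor makes the normalisation hold.\<close>
  define t where "t = 1 / (d \<bullet> \<xi> + \<beta>)"
  have t: "0 < t" "t * (d \<bullet> \<xi> + \<beta>) = 1"
    using assms(2) by (auto simp: t_def)
  have "(t *\<^sub>R \<xi>, t, t *\<^sub>R (b - A *v \<xi>)) \<in> P_feasible A b d \<beta>"
    using assms(1) t
    by (auto simp: P_feasible_def lfp_feasible_def matrix_vector_mult_scaleR algebra_simps less_eq_vec_def)
  then show ?thesis
    by blast
qed

text \<open>The slack between \<open>\<alpha>\<close> and \<open>\<alpha>'\<close> absorbs a violation of the equality constraint of (D), which is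
  all that is known of the dual vector before its complementarity with \<open>t > 0\<close> is established.\<close>
lemma P_value_le:
  fixes A :: "real^'n^'m"
  assumes ne: "P_feasible A b d \<beta> \<noteq> {}" and yzv: "(y, z, v) \<in> D_feasible A b c d \<alpha>' \<beta>"
    and le: "\<alpha> \<le> \<alpha>'"
  shows "P_value A b c d \<alpha> \<beta> \<le> z"
  unfolding P_value_def
proof (rule cSUP_least[OF ne])
  fix s assume "s \<in> P_feasible A b d \<beta>"
  then obtain x t u where s: "s = (x, t, u)" and f: "(x, t, u) \<in> P_feasible A b d \<beta>"
    by (cases s) auto
  have "0 \<le> x" "0 \<le> u" "0 \<le> t" "0 \<le> y" "0 \<le> v"
    using f yzv by (auto simp: P_feasible_def D_feasible_def)
  then have "c \<bullet> x + \<alpha>' * t \<le> z"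
    using duality_gap[OF f yzv] inner_nonneg_vec[of x v] inner_nonneg_vec[of y u] by simp
  moreover have "\<alpha> * t \<le> \<alpha>' * t"
    using le \<open>0 \<le> t\<close> by (rule mult_right_mono)
  ultimately show "P_objective c \<alpha> s \<le> z"
    by (simp add: s P_objective_def)
qed

lemma Ball_Basis_prod:
  "(\<forall>i\<in>Basis. P i) \<longleftrightarrow> (\<forall>i\<in>Basis. P (i, 0)) \<and> (\<forall>i\<in>Basis. P (0, i))"
  by (auto simp: Basis_prod_def)

lemma Ball_Basis_vec:
  fixes P :: "real^'k \<Rightarrow> bool"
  shows "(\<forall>i\<in>Basis. P i) \<longleftrightarrow> (\<forall>j. P (axis j 1))"
  by (auto simp: Basis_vec_def)

text \<open>\<open>\<theta>\<close> enters only as the supremum of (P); attainment and equality with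
  the dual value come out of the proof. Strictness of Tucker's pair in the two slack coordinates
  gives \<open>\<sigma> > 0\<close> and \<open>w > 0\<close>, so both halves can be
  dehomogenised.\<close>

lemma strict_complementary_optimal_pair:
  fixes A :: "real^'n^'m"
  assumes ne: "lfp_feasible A b \<noteq> {}" and bd: "bounded (lfp_feasible A b)"
    and pos: "\<And>\<xi>. \<xi> \<in> lfp_feasible A b \<Longrightarrow> d \<bullet> \<xi> + \<beta> > 0"
    and \<theta>: "\<theta> = P_value A b c d \<alpha> \<beta>"
  obtains x t u y v where
    "(x, t, u) \<in> P_feasible A b d \<beta>" "P_objective c \<alpha> (x, t, u) = \<theta>"
    "(y, \<theta>, v) \<in> D_feasible A b c d \<alpha> \<beta>"
    "\<And>j. 0 < x $ j \<or> 0 < v $ j" "\<And>i. 0 < u $ i \<or> 0 < y $ i"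
proof -
  \<comment> \<open>A vector \<open>(x, t, u, w, s)\<close> is orthogonal to the range of \<open>f\<close> iff \<open>A x + u = t b\<close>,
    \<open>w = d \<bullet> x + \<beta> t\<close> and \<open>s = c \<bullet> x + \<alpha> t - \<theta> w\<close>.\<close>
  define f where "f = (\<lambda>(y, z, \<sigma>).
    (transpose A *v y + z *\<^sub>R d - \<sigma> *\<^sub>R c, - (b \<bullet> y) + \<beta> * z - \<sigma> * \<alpha>, y, \<theta> * \<sigma> - z, \<sigma>))"
  have "linear f"
    by (rule linearI)
      (auto simp: f_def algebra_simps matrix_vector_right_distrib matrix_vector_mult_scaleR
        inner_simps simp del: transpose_matrix_vector)
  then have "subspace (range f)"
    by (simp add: linear_subspace_image)
  then obtain l r where l: "l \<in> range f" and r: "\<And>l. l \<in> range f \<Longrightarrow> l \<bullet> r = 0"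
    and lr: "\<And>i. i \<in> Basis \<Longrightarrow> 0 \<le> l \<bullet> i" "\<And>i. i \<in> Basis \<Longrightarrow> 0 \<le> r \<bullet> i"
      "\<And>i. i \<in> Basis \<Longrightarrow> 0 < l \<bullet> i + r \<bullet> i"
    by (rule subspace_strict_complementarity) blast
  have nonneg: "\<forall>i\<in>Basis. 0 \<le> l \<bullet> i" "\<forall>i\<in>Basis. 0 \<le> r \<bullet> i"
    and strict: "\<forall>i\<in>Basis. 0 < l \<bullet> i + r \<bullet> i"
    using lr by blast+
  obtain y z \<sigma> where l_eq: "l = f (y, z, \<sigma>)"
    using l by (metis imageE prod_cases3)
  obtain x t u w s where r_eq: "r = (x, t, u, w, s)"
    by (metis prod_cases5)
  define v where "v = transpose A *v y + z *\<^sub>R d - \<sigma> *\<^sub>R c"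
  define \<tau> where "\<tau> = - (b \<bullet> y) + \<beta> * z - \<sigma> * \<alpha>"
  have l': "l = (v, \<tau>, y, \<theta> * \<sigma> - z, \<sigma>)"
    by (simp add: l_eq f_def v_def \<tau>_def)
  note basis = Ball_Basis_prod Ball_Basis_vec inner_axis
  have v: "0 \<le> v" and \<tau>: "0 \<le> \<tau>" and y: "0 \<le> y" and z: "z \<le> \<theta> * \<sigma>" and \<sigma>: "0 \<le> \<sigma>"
    using nonneg(1) by (auto simp: l' basis less_eq_vec_def)
  have x: "0 \<le> x" and t: "0 \<le> t" and u: "0 \<le> u" and w: "0 \<le> w" and s: "0 \<le> s"
    using nonneg(2) by (auto simp: r_eq basis less_eq_vec_def)
  have vx: "0 < v $ j + x $ j" and yu: "0 < y $ i + u $ i" and zw: "0 < \<theta> * \<sigma> - z + w"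
    and \<sigma>s: "0 < \<sigma> + s" for i j
    using strict by (auto simp: l' r_eq basis)
  have eq_b: "A *v x + u = t *\<^sub>R b"
  proof -
    have "y' \<bullet> (A *v x + u - t *\<^sub>R b) = 0" for y'
    proof -
      have "f (y', 0, 0) \<bullet> r = 0"
        by (intro r rangeI)
      then show ?thesis
        using inner_transpose_mult[of A y' x]
        by (simp add: f_def r_eq inner_simps inner_commute[of b] algebra_simps del: transpose_matrix_vector)
    qed
    then show ?thesis
      using inner_eq_zero_iff[of "A *v x + u - t *\<^sub>R b"] by (simp del: inner_eq_zero_iff)
  qed
  have eq_w: "d \<bullet> x + \<beta> * t = w"
    using r[OF rangeI, of "(0, 1, 0)"] by (simp add: f_def r_eq)
  have eq_s: "c \<bullet> x + \<alpha> * t - \<theta> * w = s"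
    using r[OF rangeI, of "(0, 0, 1)"] by (simp add: f_def r_eq)
  have scaled: "(1 / w) *\<^sub>R (x, t, u) \<in> P_feasible A b d \<beta>" if "0 < w"
  proof -
    have "A *v ((1 / w) *\<^sub>R x) + (1 / w) *\<^sub>R u = (1 / w) *\<^sub>R (A *v x + u)"
      by (simp add: matrix_vector_mult_scaleR scaleR_add_right)
    moreover have "d \<bullet> ((1 / w) *\<^sub>R x) + \<beta> * ((1 / w) * t) = (1 / w) * (d \<bullet> x + \<beta> * t)"
      by (simp add: algebra_simps)
    ultimately show ?thesis
      using that x t u by (simp add: P_feasible_def eq_b eq_w less_eq_vec_def)
  qed
  have P_ne: "P_feasible A b d \<beta> \<noteq> {}"
    using ne pos P_feasible_nonempty by blast
  \<comment> \<open>\<open>s = 0\<close> in both cases. Either everything vanishes, or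
    \<open>w / t\<close> is the denominator at a point of the polyhedron, hence positive, and a
    positive \<open>s\<close> would lift the objective above the supremum \<open>\<theta>\<close>.
    Strictness of \<open>\<sigma> + s\<close> then yields \<open>\<sigma> > 0\<close>.\<close>
  have tw: "t = 0 \<and> w = 0 \<and> s = 0 \<or> 0 < t \<and> 0 < w \<and> s = 0"
  proof (rule homogenised_feasible_cases[OF ne bd eq_b x t u])
    assume "t = 0" "x = 0" "u = 0"
    then show ?thesis
      using eq_w eq_s by simp
  next
    assume "0 < t" and \<xi>: "(1 / t) *\<^sub>R x \<in> lfp_feasible A b"
    have "0 < t * (d \<bullet> ((1 / t) *\<^sub>R x) + \<beta>)"
      using pos[OF \<xi>] \<open>0 < t\<close> by simp
    also have "\<dots> = w"
      using \<open>0 < t\<close> eq_w by (simp add: algebra_simps)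
    finally have "0 < w" .
    then have "P_objective c \<alpha> ((1 / w) *\<^sub>R (x, t, u)) \<le> \<theta>"
      unfolding \<theta> by (intro P_objective_le_value ne bd pos scaled)
    moreover have "P_objective c \<alpha> ((1 / w) *\<^sub>R (x, t, u)) = (c \<bullet> x + \<alpha> * t) / w"
      by (simp add: P_objective_def add_divide_distrib)
    ultimately have "c \<bullet> x + \<alpha> * t \<le> \<theta> * w"
      using \<open>0 < w\<close> by (simp add: divide_le_eq)
    then show ?thesis
      using eq_s s \<open>0 < t\<close> \<open>0 < w\<close> by simp
  qed
  then have "0 < \<sigma>"
    using \<sigma>s by auto
  \<comment> \<open>Only \<open>\<tau> \<ge> 0\<close> is known here, so the dual equality holds
    with \<open>\<alpha>\<close> raised by \<open>\<tau> / \<sigma>\<close>; this still bounds the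
    primal supremum by \<open>z / \<sigma>\<close>.\<close>
  have dual: "(1 / \<sigma>) *\<^sub>R (y, z, v) \<in> D_feasible A b c d (\<alpha> + \<tau> / \<sigma>) \<beta>"
  proof -
    have "transpose A *v ((1 / \<sigma>) *\<^sub>R y) + (z / \<sigma>) *\<^sub>R d - (1 / \<sigma>) *\<^sub>R v = c"
      using \<open>0 < \<sigma>\<close> unfolding v_def
      by (simp add: matrix_vector_mult_scaleR scaleR_diff_right scaleR_add_right
          del: transpose_matrix_vector)
    moreover have "- (b \<bullet> ((1 / \<sigma>) *\<^sub>R y)) + \<beta> * (z / \<sigma>) = \<alpha> + \<tau> / \<sigma>"
      using \<open>0 < \<sigma>\<close> by (simp add: \<tau>_def field_simps)
    ultimately show ?thesis
      using \<open>0 < \<sigma>\<close> y v by (simp add: D_feasible_def less_eq_vec_def del: transpose_matrix_vector)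
  qed
  have "0 \<le> \<tau> / \<sigma>"
    using \<tau> \<sigma> by (rule divide_nonneg_nonneg)
  then have "\<alpha> \<le> \<alpha> + \<tau> / \<sigma>"
    by linarith
  then have "\<theta> \<le> z / \<sigma>"
    unfolding \<theta> by (rule P_value_le[OF P_ne, rotated]) (use dual in simp)
  then have z_eq: "z = \<theta> * \<sigma>"
    using z \<open>0 < \<sigma>\<close> by (simp add: le_divide_eq)
  \<comment> \<open>The slack \<open>\<theta> * \<sigma> - z\<close> is now zero, so strictness
    falls on \<open>w\<close>, which excludes the degenerate case of \<open>tw\<close>.\<close>
  then have "0 < w" "0 < t"
    using zw tw by auto
  \<comment> \<open>All terms of \<open>l \<bullet> r = 0\<close> are nonnegative, so
    \<open>\<tau> * t\<close> vanishes; with \<open>t > 0\<close> the dual equality becomes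
    exact.\<close>
  have "\<tau> = 0"
  proof -
    have "v \<bullet> x + \<tau> * t + y \<bullet> u + \<sigma> * s = 0"
      using r[OF l] by (simp add: l' r_eq z_eq)
    then have "\<tau> * t \<le> 0"
      using inner_nonneg_vec[OF v x] inner_nonneg_vec[OF y u] \<sigma> s
      by (smt (verit) mult_nonneg_nonneg)
    then show ?thesis
      using \<tau> \<open>0 < t\<close> by (simp add: mult_le_0_iff)
  qed
  show thesis
  proof
    show "((1 / w) *\<^sub>R x, (1 / w) *\<^sub>R t, (1 / w) *\<^sub>R u) \<in> P_feasible A b d \<beta>"
      using scaled \<open>0 < w\<close> by simp
    have "c \<bullet> x + \<alpha> * t = \<theta> * w"
      using eq_s tw by auto
    then show "P_objective c \<alpha> ((1 / w) *\<^sub>R x, (1 / w) *\<^sub>R t, (1 / w) *\<^sub>R u) = \<theta>"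
      using \<open>0 < w\<close> by (simp add: P_objective_def field_simps)
    show "((1 / \<sigma>) *\<^sub>R y, \<theta>, (1 / \<sigma>) *\<^sub>R v) \<in> D_feasible A b c d \<alpha> \<beta>"
      using dual \<open>\<tau> = 0\<close> \<open>0 < \<sigma>\<close> by (simp add: z_eq)
    show "0 < ((1 / w) *\<^sub>R x) $ j \<or> 0 < ((1 / \<sigma>) *\<^sub>R v) $ j" for j
      using vx[of j] \<open>0 < w\<close> \<open>0 < \<sigma>\<close> by (auto simp: zero_less_divide_iff)
    show "0 < ((1 / w) *\<^sub>R u) $ i \<or> 0 < ((1 / \<sigma>) *\<^sub>R y) $ i" for i
      using yu[of i] \<open>0 < w\<close> \<open>0 < \<sigma>\<close> by (auto simp: zero_less_divide_iff)
  qed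
qed

section \<open>Weak duality and the optimal sets as level sets\<close>

lemma complementary_slackness:
  assumes "(x, t, u) \<in> P_feasible A b d \<beta>" "P_objective c \<alpha> (x, t, u) = \<theta>"
    and "(y, \<theta>, v) \<in> D_feasible A b c d \<alpha> \<beta>"
  shows "x \<bullet> v = 0" "y \<bullet> u = 0"
proof -
  have "0 \<le> x" "0 \<le> u" "0 \<le> y" "0 \<le> v"
    using assms by (auto simp: P_feasible_def D_feasible_def)
  moreover have "x \<bullet> v + y \<bullet> u = 0"
    using duality_gap[OF assms(1,3)] assms(2) by (simp add: P_objective_def)
  ultimately show "x \<bullet> v = 0" "y \<bullet> u = 0"
    using inner_nonneg_vec[of x v] inner_nonneg_vec[of y u] by linarith+
qed

lemma weak_duality:
  assumes "(x, t, u) \<in> P_feasible A b d \<beta>" "(y, z, v) \<in> D_feasible A b c d \<alpha> \<beta>"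
  shows "P_objective c \<alpha> (x, t, u) \<le> z"
proof -
  have "0 \<le> x" "0 \<le> u" "0 \<le> y" "0 \<le> v"
    using assms by (auto simp: P_feasible_def D_feasible_def)
  then show ?thesis
    using duality_gap[OF assms] inner_nonneg_vec[of x v] inner_nonneg_vec[of y u]
    by (simp add: P_objective_def)
qed

text \<open>One feasible pair with equal objective values certifies, by weak duality, that
  \<open>\<theta>\<close> is both the maximum and the minimum. The optimal sets are thereby
  described by equations and sign constraints.\<close>

lemma optimal_sets_eq:
  assumes P: "(x, t, u) \<in> P_feasible A b d \<beta>" "P_objective c \<alpha> (x, t, u) = \<theta>"
    and D: "(y, \<theta>, v) \<in> D_feasible A b c d \<alpha> \<beta>"
  shows "P_optimal A b c d \<alpha> \<beta> = {s \<in> P_feasible A b d \<beta>. P_objective c \<alpha> s = \<theta>}"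
    and "D_optimal A b c d \<alpha> \<beta> = {s \<in> D_feasible A b c d \<alpha> \<beta>. D_objective s = \<theta>}"
proof -
  have "P_objective c \<alpha> s \<le> \<theta>" if "s \<in> P_feasible A b d \<beta>" for s
    using weak_duality[OF _ D] that by (cases s) auto
  then show "P_optimal A b c d \<alpha> \<beta> = {s \<in> P_feasible A b d \<beta>. P_objective c \<alpha> s = \<theta>}"
    using P by (force simp: P_optimal_def is_arg_max_def)
  have "\<theta> \<le> D_objective s" if "s \<in> D_feasible A b c d \<alpha> \<beta>" for s
    using weak_duality[OF P(1)] P(2) that by (cases s) (auto simp: D_objective_def)
  moreover have "D_objective (y, \<theta>, v) = \<theta>"
    by (simp add: D_objective_def)
  ultimately show "D_optimal A b c d \<alpha> \<beta> = {s \<in> D_feasible A b c d \<alpha> \<beta>. D_objective s = \<theta>}"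
    using D by (force simp: D_optimal_def is_arg_min_def)
qed

section \<open>Relative interiors of the optimal faces\<close>

text \<open>Moving from \<open>a\<close> through \<open>x\<close> and slightly beyond: coordinates
  positive at \<open>x\<close> stay positive by continuity, and those that vanish at
  \<open>x\<close> vanish at \<open>a\<close> too, hence along the whole line.\<close>

lemma eventually_prolong_nonneg:
  fixes a x :: "real^'k"
  assumes "0 \<le> a" "0 \<le> x" "\<And>j. 0 < a $ j \<Longrightarrow> 0 < x $ j"
  shows "\<forall>\<^sub>F e in at_right 1. 0 \<le> (1 - e) *\<^sub>R a + e *\<^sub>R x"
proof -
  have "\<forall>\<^sub>F e in at_right 1. 0 \<le> (1 - e) * a $ j + e * x $ j" for j
  proof (cases "0 < x $ j")
    case True
    have "((\<lambda>e. (1 - e) * a $ j + e * x $ j) \<longlongrightarrow> (1 - 1) * a $ j + 1 * x $ j) (at_right 1)"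
      by (intro tendsto_intros)
    then have "\<forall>\<^sub>F e in at_right 1. 0 < (1 - e) * a $ j + e * x $ j"
      using True by (intro order_tendstoD) simp_all
    then show ?thesis
      by (rule eventually_mono) simp
  next
    case False
    moreover have "0 \<le> a $ j" "0 \<le> x $ j"
      using assms(1,2) by (auto simp: less_eq_vec_def)
    ultimately have "a $ j = 0" "x $ j = 0"
      using assms(3)[of j] by linarith+
    then show ?thesis
      by simp
  qed
  then show ?thesis
    by (simp add: less_eq_vec_def eventually_all_finite)
qed

text \<open>A point of a convex set is relatively interior iff every segment from the set to that
  point can be prolonged inside the set. The filter form lets finitely many sign conditions be
  checked separately.\<close>

lemma rel_interior_prolongI:
  fixes S :: "'a::euclidean_space set"
  assumes "convex S" "x \<in> S"
    and "\<And>a. a \<in> S \<Longrightarrow> \<forall>\<^sub>F e in at_right (1::real). (1 - e) *\<^sub>R a + e *\<^sub>R x \<in> S"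
  shows "x \<in> rel_interior S"
proof -
  have "\<exists>e>1. (1 - e) *\<^sub>R a + e *\<^sub>R x \<in> S" if "a \<in> S" for a
  proof -
    have "\<forall>\<^sub>F e in at_right (1::real). 1 < e \<and> (1 - e) *\<^sub>R a + e *\<^sub>R x \<in> S"
      using assms(3)[OF that] eventually_at_right_less by eventually_elim simp
    then show ?thesis
      using eventually_happens' trivial_limit_at_right_real by blast
  qed
  then show ?thesis
    using assms(1,2) convex_rel_interior_iff[of S x] by blast
qed

text \<open>Affine combinations preserve the equations, and maximal support keeps the entries of
  \<open>x\<close> and \<open>u\<close> nonnegative a little beyond the point. The scalar
  \<open>t\<close> is handled by its positivity.\<close>

lemma P_face_rel_interior:
  fixes A :: "real^'n^'m" and b :: "real^'m" and c d :: "real^'n" and \<alpha> \<beta> \<theta> :: real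
  defines "F \<equiv> {s \<in> P_feasible A b d \<beta>. P_objective c \<alpha> s = \<theta>}"
  assumes F: "(x, t, u) \<in> F" and "0 < t"
    and supp: "\<And>x' t' u' j. (x', t', u') \<in> F \<Longrightarrow> 0 < x' $ j \<Longrightarrow> 0 < x $ j"
      "\<And>x' t' u' i. (x', t', u') \<in> F \<Longrightarrow> 0 < u' $ i \<Longrightarrow> 0 < u $ i"
  shows "(x, t, u) \<in> rel_interior F"
proof -
  \<comment> \<open>\<open>e\<close> ranges over all reals: values in \<open>[0, 1]\<close> serve
    convexity, values slightly above 1 serve the prolongation.\<close>
  have comb: "(1 - e) *\<^sub>R (x', t', u') + e *\<^sub>R (x'', t'', u'') \<in> F"
    if "(x', t', u') \<in> F" "(x'', t'', u'') \<in> F" "0 \<le> (1 - e) *\<^sub>R x' + e *\<^sub>R x''"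
      "0 \<le> (1 - e) * t' + e * t''" "0 \<le> (1 - e) *\<^sub>R u' + e *\<^sub>R u''"
    for e x' x'' t' t'' u' u''
  proof -
    have u: "u' = t' *\<^sub>R b - A *v x'" "u'' = t'' *\<^sub>R b - A *v x''"
      and n: "d \<bullet> x' + \<beta> * t' = 1" "d \<bullet> x'' + \<beta> * t'' = 1"
      and o: "c \<bullet> x' + \<alpha> * t' = \<theta>" "c \<bullet> x'' + \<alpha> * t'' = \<theta>"
      using that(1,2) by (auto simp: F_def P_feasible_def P_objective_def algebra_simps)
    have "A *v ((1 - e) *\<^sub>R x' + e *\<^sub>R x'') + ((1 - e) *\<^sub>R u' + e *\<^sub>R u'') = ((1 - e) * t' + e * t'') *\<^sub>R b"
      unfolding u by (simp add: matrix_vector_right_distrib matrix_vector_mult_scaleR algebra_simps)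
    moreover have "d \<bullet> ((1 - e) *\<^sub>R x' + e *\<^sub>R x'') + \<beta> * ((1 - e) * t' + e * t'') =
        (1 - e) * (d \<bullet> x' + \<beta> * t') + e * (d \<bullet> x'' + \<beta> * t'')"
      by (simp add: inner_simps algebra_simps)
    moreover have "c \<bullet> ((1 - e) *\<^sub>R x' + e *\<^sub>R x'') + \<alpha> * ((1 - e) * t' + e * t'') =
        (1 - e) * (c \<bullet> x' + \<alpha> * t') + e * (c \<bullet> x'' + \<alpha> * t'')"
      by (simp add: inner_simps algebra_simps)
    moreover have "(1 - e) * \<theta> + e * \<theta> = \<theta>"
      by (simp add: algebra_simps)
    ultimately show ?thesis
      using that(3-5) by (simp add: F_def P_feasible_def P_objective_def n o)
  qed
  have nonneg: "0 \<le> x'" "0 \<le> t'" "0 \<le> u'" if "(x', t', u') \<in> F" for x' t' u'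
    using that by (auto simp: F_def P_feasible_def)
  have "convex F"
  proof (rule convexI)
    fix s' s'' :: "(real^'n) \<times> real \<times> (real^'m)" and \<mu> \<nu> :: real
    assume s: "s' \<in> F" "s'' \<in> F" and \<mu>: "0 \<le> \<mu>" "0 \<le> \<nu>" "\<mu> + \<nu> = 1"
    from \<mu> have \<mu>_eq: "\<mu> = 1 - \<nu>"
      by simp
    moreover obtain x' t' u' x'' t'' u'' where "s' = (x', t', u')" "s'' = (x'', t'', u'')"
      by (metis prod_cases3)
    ultimately show "\<mu> *\<^sub>R s' + \<nu> *\<^sub>R s'' \<in> F"
      using comb[of x' t' u' x'' t'' u'' \<nu>] s \<mu> nonneg[of x' t' u'] nonneg[of x'' t'' u'']
      by (simp add: \<mu>_eq less_eq_vec_def)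
  qed
  then show ?thesis
  proof (rule rel_interior_prolongI[OF _ F])
    fix s assume "s \<in> F"
    then obtain x' t' u' where s: "s = (x', t', u')" and f: "(x', t', u') \<in> F"
      by (cases s) auto
    have "((\<lambda>e. (1 - e) * t' + e * t) \<longlongrightarrow> (1 - 1) * t' + 1 * t) (at_right 1)"
      by (intro tendsto_intros)
    then have "\<forall>\<^sub>F e in at_right 1. 0 < (1 - e) * t' + e * t"
      using \<open>0 < t\<close> by (intro order_tendstoD) simp_all
    moreover have "\<forall>\<^sub>F e in at_right 1. 0 \<le> (1 - e) *\<^sub>R x' + e *\<^sub>R x"
      using nonneg[OF f] nonneg[OF F] supp(1)[OF f] by (intro eventually_prolong_nonneg)
    moreover have "\<forall>\<^sub>F e in at_right 1. 0 \<le> (1 - e) *\<^sub>R u' + e *\<^sub>R u"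
      using nonneg[OF f] nonneg[OF F] supp(2)[OF f] by (intro eventually_prolong_nonneg)
    ultimately show "\<forall>\<^sub>F e in at_right 1. (1 - e) *\<^sub>R s + e *\<^sub>R (x, t, u) \<in> F"
      unfolding s by eventually_elim (intro comb f F, auto)
  qed
qed

text \<open>As for the primal face; \<open>z\<close> is constant on the face, so only
  \<open>y\<close> and \<open>v\<close> constrain the prolongation.\<close>

lemma D_face_rel_interior:
  fixes A :: "real^'n^'m" and b :: "real^'m" and c d :: "real^'n" and \<alpha> \<beta> \<theta> :: real
  defines "F \<equiv> {s \<in> D_feasible A b c d \<alpha> \<beta>. D_objective s = \<theta>}"
  assumes F: "(y, z, v) \<in> F"
    and supp: "\<And>y' z' v' i. (y', z', v') \<in> F \<Longrightarrow> 0 < y' $ i \<Longrightarrow> 0 < y $ i"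
      "\<And>y' z' v' j. (y', z', v') \<in> F \<Longrightarrow> 0 < v' $ j \<Longrightarrow> 0 < v $ j"
  shows "(y, z, v) \<in> rel_interior F"
proof -
  have comb: "(1 - e) *\<^sub>R (y', z', v') + e *\<^sub>R (y'', z'', v'') \<in> F"
    if "(y', z', v') \<in> F" "(y'', z'', v'') \<in> F" "0 \<le> (1 - e) *\<^sub>R y' + e *\<^sub>R y''"
      "0 \<le> (1 - e) *\<^sub>R v' + e *\<^sub>R v''"
    for e y' y'' z' z'' v' v''
  proof -
    have v: "v' = transpose A *v y' + \<theta> *\<^sub>R d - c" "v'' = transpose A *v y'' + \<theta> *\<^sub>R d - c"
      and n: "b \<bullet> y' = \<beta> * \<theta> - \<alpha>" "b \<bullet> y'' = \<beta> * \<theta> - \<alpha>"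
      and z: "z' = \<theta>" "z'' = \<theta>"
      using that(1,2)
      by (auto simp: F_def D_feasible_def D_objective_def algebra_simps simp del: transpose_matrix_vector)
    have "transpose A *v ((1 - e) *\<^sub>R y' + e *\<^sub>R y'') + \<theta> *\<^sub>R d - ((1 - e) *\<^sub>R v' + e *\<^sub>R v'') = c"
      unfolding v by (simp add: matrix_vector_right_distrib matrix_vector_mult_scaleR algebra_simps
          del: transpose_matrix_vector)
    moreover have "- (b \<bullet> ((1 - e) *\<^sub>R y' + e *\<^sub>R y'')) + \<beta> * \<theta> = \<alpha>"
      by (simp add: inner_simps n algebra_simps)
    moreover have "(1 - e) * \<theta> + e * \<theta> = \<theta>"
      by (simp add: algebra_simps)
    ultimately show ?thesis
      using that(3,4) by (simp add: F_def D_feasible_def D_objective_def z del: transpose_matrix_vector)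
  qed
  have nonneg: "0 \<le> y'" "0 \<le> v'" if "(y', z', v') \<in> F" for y' z' v'
    using that by (auto simp: F_def D_feasible_def)
  have "convex F"
  proof (rule convexI)
    fix s' s'' :: "(real^'m) \<times> real \<times> (real^'n)" and \<mu> \<nu> :: real
    assume s: "s' \<in> F" "s'' \<in> F" and \<mu>: "0 \<le> \<mu>" "0 \<le> \<nu>" "\<mu> + \<nu> = 1"
    from \<mu> have \<mu>_eq: "\<mu> = 1 - \<nu>"
      by simp
    moreover obtain y' z' v' y'' z'' v'' where "s' = (y', z', v')" "s'' = (y'', z'', v'')"
      by (metis prod_cases3)
    ultimately show "\<mu> *\<^sub>R s' + \<nu> *\<^sub>R s'' \<in> F"
      using comb[of y' z' v' y'' z'' v'' \<nu>] s \<mu> nonneg[of y' z' v'] nonneg[of y'' z'' v'']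
      by (simp add: \<mu>_eq less_eq_vec_def)
  qed
  then show ?thesis
  proof (rule rel_interior_prolongI[OF _ F])
    fix s assume "s \<in> F"
    then obtain y' z' v' where s: "s = (y', z', v')" and f: "(y', z', v') \<in> F"
      by (cases s) auto
    have "\<forall>\<^sub>F e in at_right 1. 0 \<le> (1 - e) *\<^sub>R y' + e *\<^sub>R y"
      using nonneg[OF f] nonneg[OF F] supp(1)[OF f] by (intro eventually_prolong_nonneg)
    moreover have "\<forall>\<^sub>F e in at_right 1. 0 \<le> (1 - e) *\<^sub>R v' + e *\<^sub>R v"
      using nonneg[OF f] nonneg[OF F] supp(2)[OF f] by (intro eventually_prolong_nonneg)
    ultimately show "\<forall>\<^sub>F e in at_right 1. (1 - e) *\<^sub>R s + e *\<^sub>R (y, z, v) \<in> F"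
      unfolding s by eventually_elim (intro comb f F, auto)
  qed
qed

section \<open>The auxiliary programs\<close>

text \<open>Absorbs an added vector \<open>x0\<close> into the two summands, pushing as much as the
  cap 1 permits into the rewarded part \<open>x2'\<close>. If that part does not grow, the support
  of \<open>x0\<close> was already covered.\<close>

lemma split_increase_vec:
  fixes x1 x2 x0 :: "real^'k"
  assumes "0 \<le> x1" "0 \<le> x2" "x2 \<le> 1" "0 \<le> x0"
  obtains x1' x2' where "x1' + x2' = x1 + x2 + x0" "0 \<le> x1'" "0 \<le> x2'" "x2' \<le> 1" "x2 \<le> x2'"
    "\<And>j. 0 < x0 $ j \<Longrightarrow> x2 = x2' \<Longrightarrow> 0 < (x1 + x2) $ j"
proof
  define m where "m = (\<chi> j. min 1 ((x1 + x2 + x0) $ j))"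
  show "(x1 + x2 + x0 - m) + m = x1 + x2 + x0"
    by simp
  show "0 \<le> x1 + x2 + x0 - m" "0 \<le> m" "m \<le> 1" "x2 \<le> m"
    using assms by (auto simp: m_def less_eq_vec_def)
  \<comment> \<open>Where the cap is active, \<open>x2 $ j = 1\<close>; otherwise
    \<open>x2 = m\<close> would force \<open>x1 $ j + x0 $ j = 0\<close>, against
    \<open>x0 $ j > 0\<close>.\<close>
  show "0 < (x1 + x2) $ j" if j: "0 < x0 $ j" and "x2 = m" for j
  proof -
    have "x2 $ j = min 1 ((x1 + x2 + x0) $ j)"
      using \<open>x2 = m\<close> by (simp add: m_def vec_eq_iff)
    moreover have "0 \<le> x1 $ j" "0 \<le> x2 $ j"
      using assms by (auto simp: less_eq_vec_def)
    ultimately show ?thesis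
      using j by (simp add: min_def split: if_splits)
  qed
qed

lemma sum_vec_mono:
  fixes x y :: "real^'k"
  shows "x \<le> y \<Longrightarrow> sum (($) x) UNIV \<le> sum (($) y) UNIV"
  by (simp add: less_eq_vec_def sum_mono)

lemma sum_vec_le_imp_eq:
  fixes x y :: "real^'k"
  assumes "x \<le> y" "sum (($) y) UNIV \<le> sum (($) x) UNIV"
  shows "x = y"
proof -
  have "sum (\<lambda>j. y $ j - x $ j) UNIV = 0"
    using sum_vec_mono[OF assms(1)] assms(2) by (simp add: sum_subtractf)
  then have "\<forall>j\<in>UNIV. y $ j - x $ j = 0"
    using assms(1) by (intro sum_nonneg_eq_0_iff[THEN iffD1]) (simp_all add: less_eq_vec_def)
  then show ?thesis
    by (simp add: vec_eq_iff)
qed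

text \<open>Optimality bounds only the total objective; as all blocks weakly increase, a total that
  does not grow fixes each of them.\<close>

lemma objective_terms_eq:
  fixes x x' :: "real^'k" and u u' :: "real^'l" and w w' :: real
  assumes "x \<le> x'" "u \<le> u'" "w \<le> w'"
    and "\<not> sum (($) x) UNIV + sum (($) u) UNIV + w < sum (($) x') UNIV + sum (($) u') UNIV + w'"
  shows "x = x'" "u = u'" "w = w'"
proof -
  show "x = x'" "u = u'"
    using assms sum_vec_mono[OF assms(1)] sum_vec_mono[OF assms(2)]
    by (auto intro!: sum_vec_le_imp_eq)
  then show "w = w'"
    using assms by simp
qed

text \<open>\<open>(x0, t0, u0)\<close> with weight 1 lies in the homogeneous cone, the weight being
  its normalisation \<open>d \<bullet> x0 + \<beta> * t0\<close>. Adding it and redistributing gives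
  a feasible competitor, so optimality freezes the capped parts, and the supports already contain
  those of \<open>x0\<close> and \<open>u0\<close>.\<close>

lemma aux_P_support:
  fixes A :: "real^'n^'m"
  assumes opt: "is_arg_max aux_P_objective (\<lambda>s. s \<in> aux_P_feasible A b c d \<alpha> \<beta> \<theta>)
         (p, x1, x2, u1, u2, w1, w2)"
    and P: "(x0, t0, u0) \<in> P_feasible A b d \<beta>" "P_objective c \<alpha> (x0, t0, u0) = \<theta>"
  shows "0 < w1 + w2" "0 < x0 $ j \<Longrightarrow> 0 < (x1 + x2) $ j" "0 < u0 $ i \<Longrightarrow> 0 < (u1 + u2) $ i"
proof -
  have f: "A *v (x1 + x2) - p *\<^sub>R b + u1 + u2 = 0" "d \<bullet> (x1 + x2) + \<beta> * p - (w1 + w2) = 0"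
      "c \<bullet> (x1 + x2) + \<alpha> * p - \<theta> * (w1 + w2) = 0"
    and nn: "0 \<le> p" "0 \<le> x1" "0 \<le> u1" "0 \<le> w1" "0 \<le> x2" "0 \<le> u2" "0 \<le> w2"
      "x2 \<le> 1" "u2 \<le> 1" "w2 \<le> 1"
    using opt by (auto simp: is_arg_max_def aux_P_feasible_def)
  have f0: "A *v x0 + u0 = t0 *\<^sub>R b" "d \<bullet> x0 + \<beta> * t0 = 1" "c \<bullet> x0 + \<alpha> * t0 = \<theta>"
    and nn0: "0 \<le> x0" "0 \<le> t0" "0 \<le> u0"
    using P by (auto simp: P_feasible_def P_objective_def)
  obtain x1' x2' where x': "x1' + x2' = x1 + x2 + x0" "0 \<le> x1'" "0 \<le> x2'" "x2' \<le> 1" "x2 \<le> x2'"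
    and x_supp: "\<And>j. 0 < x0 $ j \<Longrightarrow> x2 = x2' \<Longrightarrow> 0 < (x1 + x2) $ j"
    using split_increase_vec[OF nn(2,5,8) nn0(1)] by blast
  obtain u1' u2' where u': "u1' + u2' = u1 + u2 + u0" "0 \<le> u1'" "0 \<le> u2'" "u2' \<le> 1" "u2 \<le> u2'"
    and u_supp: "\<And>i. 0 < u0 $ i \<Longrightarrow> u2 = u2' \<Longrightarrow> 0 < (u1 + u2) $ i"
    using split_increase_vec[OF nn(3,6,9) nn0(3)] by blast
  define w2' where "w2' = min 1 (w1 + w2 + 1)"
  define w1' where "w1' = w1 + w2 + 1 - w2'"
  have w': "w1' + w2' = w1 + w2 + 1" "0 \<le> w1'" "0 \<le> w2'" "w2' \<le> 1" "w2 \<le> w2'"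
    using nn by (auto simp: w1'_def w2'_def)
  have "(p + t0, x1', x2', u1', u2', w1', w2') \<in> aux_P_feasible A b c d \<alpha> \<beta> \<theta>"
  proof -
    have "A *v (x1 + x2 + x0) - (p + t0) *\<^sub>R b + (u1 + u2 + u0) =
        (A *v (x1 + x2) - p *\<^sub>R b + u1 + u2) + (A *v x0 + u0 - t0 *\<^sub>R b)"
      by (simp add: matrix_vector_right_distrib algebra_simps)
    then have "A *v (x1' + x2') - (p + t0) *\<^sub>R b + u1' + u2' = 0"
      using f f0 unfolding add.assoc[of _ u1'] x'(1) u'(1) by simp
    moreover have "d \<bullet> (x1' + x2') + \<beta> * (p + t0) - (w1' + w2') = 0"
      using f f0 by (simp add: x'(1) w'(1) inner_add_right algebra_simps)
    moreover have "c \<bullet> (x1' + x2') + \<alpha> * (p + t0) - \<theta> * (w1' + w2') = 0"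
      using f f0 by (simp add: x'(1) w'(1) inner_add_right algebra_simps)
    ultimately show ?thesis
      using x' u' w' nn nn0 by (simp add: aux_P_feasible_def)
  qed
  then have "\<not> aux_P_objective (p, x1, x2, u1, u2, w1, w2)
      < aux_P_objective (p + t0, x1', x2', u1', u2', w1', w2')"
    using opt by (simp add: is_arg_max_def)
  then have eq: "x2 = x2'" "u2 = u2'" "w2 = w2'"
    using objective_terms_eq[OF x'(5) u'(5) w'(5)] by (simp_all add: aux_P_objective_def)
  \<comment> \<open>As \<open>w1 + w2 \<ge> 0\<close>, the cap gives \<open>w2' = 1\<close>, so the
    optimal solution has \<open>w2 = 1\<close>.\<close>
  show "0 < w1 + w2"
    using eq(3) nn by (auto simp: w2'_def min_def split: if_splits)
  show "0 < (x1 + x2) $ j" if "0 < x0 $ j"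
    using x_supp that eq by blast
  show "0 < (u1 + u2) $ i" if "0 < u0 $ i"
    using u_supp that eq by blast
qed

text \<open>Here the added cone element is \<open>(\<theta>, y0, v0)\<close> with weight 1; its
  entry \<open>\<theta>\<close> keeps the row \<open>q - \<theta> * (w1 + w2) = 0\<close>
  satisfied.\<close>

lemma aux_D_support:
  fixes A :: "real^'n^'m"
  assumes opt: "is_arg_max aux_D_objective (\<lambda>s. s \<in> aux_D_feasible A b c d \<alpha> \<beta> \<theta>)
         (q, y1, y2, v1, v2, w1, w2)"
    and D: "(y0, \<theta>, v0) \<in> D_feasible A b c d \<alpha> \<beta>"
  shows "0 < w1 + w2" "0 < y0 $ i \<Longrightarrow> 0 < (y1 + y2) $ i" "0 < v0 $ j \<Longrightarrow> 0 < (v1 + v2) $ j"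
proof -
  have f: "transpose A *v (y1 + y2) + q *\<^sub>R d - (v1 + v2) - (w1 + w2) *\<^sub>R c = 0"
      "- (b \<bullet> (y1 + y2)) + \<beta> * q - \<alpha> * (w1 + w2) = 0" "q - \<theta> * (w1 + w2) = 0"
    and nn: "0 \<le> y1" "0 \<le> v1" "0 \<le> w1" "0 \<le> y2" "0 \<le> v2" "0 \<le> w2"
      "y2 \<le> 1" "v2 \<le> 1" "w2 \<le> 1"
    using opt by (auto simp: is_arg_max_def aux_D_feasible_def simp del: transpose_matrix_vector)
  have f0: "transpose A *v y0 + \<theta> *\<^sub>R d - v0 = c" "- (b \<bullet> y0) + \<beta> * \<theta> = \<alpha>"
    and nn0: "0 \<le> y0" "0 \<le> v0"
    using D by (auto simp: D_feasible_def simp del: transpose_matrix_vector)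
  obtain y1' y2' where y': "y1' + y2' = y1 + y2 + y0" "0 \<le> y1'" "0 \<le> y2'" "y2' \<le> 1" "y2 \<le> y2'"
    and y_supp: "\<And>j. 0 < y0 $ j \<Longrightarrow> y2 = y2' \<Longrightarrow> 0 < (y1 + y2) $ j"
    using split_increase_vec[OF nn(1,4,7) nn0(1)] by blast
  obtain v1' v2' where v': "v1' + v2' = v1 + v2 + v0" "0 \<le> v1'" "0 \<le> v2'" "v2' \<le> 1" "v2 \<le> v2'"
    and v_supp: "\<And>i. 0 < v0 $ i \<Longrightarrow> v2 = v2' \<Longrightarrow> 0 < (v1 + v2) $ i"
    using split_increase_vec[OF nn(2,5,8) nn0(2)] by blast
  define w2' where "w2' = min 1 (w1 + w2 + 1)"
  define w1' where "w1' = w1 + w2 + 1 - w2'"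
  have w': "w1' + w2' = w1 + w2 + 1" "0 \<le> w1'" "0 \<le> w2'" "w2' \<le> 1" "w2 \<le> w2'"
    using nn by (auto simp: w1'_def w2'_def)
  have "(q + \<theta>, y1', y2', v1', v2', w1', w2') \<in> aux_D_feasible A b c d \<alpha> \<beta> \<theta>"
  proof -
    have "transpose A *v (y1 + y2 + y0) + (q + \<theta>) *\<^sub>R d - (v1 + v2 + v0) - (w1 + w2 + 1) *\<^sub>R c =
        (transpose A *v (y1 + y2) + q *\<^sub>R d - (v1 + v2) - (w1 + w2) *\<^sub>R c) +
        (transpose A *v y0 + \<theta> *\<^sub>R d - v0 - c)"
      by (simp add: matrix_vector_right_distrib algebra_simps del: transpose_matrix_vector)
    then have "transpose A *v (y1' + y2') + (q + \<theta>) *\<^sub>R d - (v1' + v2') - (w1' + w2') *\<^sub>R c = 0"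
      unfolding y'(1) v'(1) w'(1) f(1) f0(1) by simp
    moreover have "- (b \<bullet> (y1' + y2')) + \<beta> * (q + \<theta>) - \<alpha> * (w1' + w2') = 0"
      using f f0 by (simp add: y'(1) w'(1) inner_add_right algebra_simps del: transpose_matrix_vector)
    moreover have "(q + \<theta>) - \<theta> * (w1' + w2') = 0"
      using f by (simp add: w'(1) algebra_simps del: transpose_matrix_vector)
    ultimately show ?thesis
      using y' v' w' nn nn0 by (simp add: aux_D_feasible_def del: transpose_matrix_vector)
  qed
  then have "\<not> aux_D_objective (q, y1, y2, v1, v2, w1, w2)
      < aux_D_objective (q + \<theta>, y1', y2', v1', v2', w1', w2')"
    using opt by (simp add: is_arg_max_def)
  then have eq: "y2 = y2'" "v2 = v2'" "w2 = w2'"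
    using objective_terms_eq[OF y'(5) v'(5) w'(5)] by (simp_all add: aux_D_objective_def)
  show "0 < w1 + w2"
    using eq(3) nn by (auto simp: w2'_def min_def split: if_splits)
  show "0 < (y1 + y2) $ i" if "0 < y0 $ i"
    using y_supp that eq by blast
  show "0 < (v1 + v2) $ j" if "0 < v0 $ j"
    using v_supp that eq by blast
qed

section \<open>Normalising auxiliary solutions to points of the optimal faces\<close>

lemma aux_P_normalised:
  fixes A :: "real^'n^'m"
  assumes "(p, x1, x2, u1, u2, w1, w2) \<in> aux_P_feasible A b c d \<alpha> \<beta> \<theta>" and w: "0 < w1 + w2"
    and xtu: "(x, t, u) = (1 / (w1 + w2)) *\<^sub>R (x1 + x2, p, u1 + u2)"
  shows "(x, t, u) \<in> P_feasible A b d \<beta>" "P_objective c \<alpha> (x, t, u) = \<theta>"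
proof -
  define k where "k = w1 + w2"
  have f: "A *v (x1 + x2) = p *\<^sub>R b - (u1 + u2)" "d \<bullet> (x1 + x2) + \<beta> * p = k"
      "c \<bullet> (x1 + x2) + \<alpha> * p = \<theta> * k"
    and nn: "0 \<le> p" "0 \<le> x1" "0 \<le> u1" "0 \<le> x2" "0 \<le> u2"
    using assms(1) by (auto simp: aux_P_feasible_def k_def algebra_simps eq_neg_iff_add_eq_0)
  have k: "0 < k" and eq: "x = (1 / k) *\<^sub>R (x1 + x2)" "t = p / k" "u = (1 / k) *\<^sub>R (u1 + u2)"
    using w xtu by (simp_all add: k_def)
  have "A *v x + u = t *\<^sub>R b"
    by (simp only: eq matrix_vector_mult_scaleR f) (simp add: algebra_simps)
  moreover have "d \<bullet> x + \<beta> * t = (d \<bullet> (x1 + x2) + \<beta> * p) / k"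
    by (simp add: eq inner_add_right add_divide_distrib)
  moreover have "c \<bullet> x + \<alpha> * t = (c \<bullet> (x1 + x2) + \<alpha> * p) / k"
    by (simp add: eq inner_add_right add_divide_distrib)
  moreover have "0 \<le> x" "0 \<le> t" "0 \<le> u"
    using k nn by (auto simp: eq less_eq_vec_def)
  ultimately show "(x, t, u) \<in> P_feasible A b d \<beta>" "P_objective c \<alpha> (x, t, u) = \<theta>"
    using k by (simp_all add: P_feasible_def P_objective_def f)
qed

lemma aux_D_normalised:
  fixes A :: "real^'n^'m"
  assumes "(q, y1, y2, v1, v2, w1, w2) \<in> aux_D_feasible A b c d \<alpha> \<beta> \<theta>" and w: "0 < w1 + w2"
    and yzv: "(y, z, v) = (1 / (w1 + w2)) *\<^sub>R (y1 + y2, q, v1 + v2)"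
  shows "(y, z, v) \<in> D_feasible A b c d \<alpha> \<beta>" "z = \<theta>"
proof -
  define k where "k = w1 + w2"
  have f: "transpose A *v (y1 + y2) = (v1 + v2) + k *\<^sub>R c - (\<theta> * k) *\<^sub>R d"
      "b \<bullet> (y1 + y2) = \<beta> * (\<theta> * k) - \<alpha> * k" "q = \<theta> * k"
    and nn: "0 \<le> y1" "0 \<le> v1" "0 \<le> y2" "0 \<le> v2"
    using assms(1)
    by (auto simp: aux_D_feasible_def k_def algebra_simps simp del: transpose_matrix_vector)
  have k: "0 < k" and eq: "y = (1 / k) *\<^sub>R (y1 + y2)" "z = q / k" "v = (1 / k) *\<^sub>R (v1 + v2)"
    using w yzv by (simp_all add: k_def)
  show z: "z = \<theta>"
    using k by (simp add: eq f)
  have "transpose A *v y + \<theta> *\<^sub>R d - v = c"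
    using k by (simp only: eq matrix_vector_mult_scaleR f) (simp add: algebra_simps)
  moreover have "b \<bullet> y = \<beta> * \<theta> - \<alpha>"
    using k by (simp only: eq inner_scaleR_right f) (simp add: field_simps)
  moreover have "0 \<le> y" "0 \<le> v"
    using k nn by (auto simp: eq less_eq_vec_def)
  ultimately show "(y, z, v) \<in> D_feasible A b c d \<alpha> \<beta>"
    by (simp add: D_feasible_def z del: transpose_matrix_vector)
qed

theorem mainTheorem3:
  fixes A :: "real^'n^'m" and b :: "real^'m" and c d :: "real^'n"
    and \<alpha> \<beta> \<theta> :: real
    and p wP1 wP2 q wD1 wD2 t z :: real
    and x1 x2 v1 v2 x v :: "real^'n"
    and u1 u2 y1 y2 u y :: "real^'m"
  assumes X_nonempty: "lfp_feasible A b \<noteq> {}"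
    and X_bounded: "bounded (lfp_feasible A b)"
    and denominator_pos: "\<And>\<xi>. \<xi> \<in> lfp_feasible A b \<Longrightarrow> d \<bullet> \<xi> + \<beta> > 0"
    and value_P: "\<theta> = P_value A b c d \<alpha> \<beta>"
    and value_D: "\<theta> = D_value A b c d \<alpha> \<beta>"
    and optimal_aux_P:
      "is_arg_max aux_P_objective (\<lambda>s. s \<in> aux_P_feasible A b c d \<alpha> \<beta> \<theta>)
         (p, x1, x2, u1, u2, wP1, wP2)"
    and optimal_aux_D:
      "is_arg_max aux_D_objective (\<lambda>s. s \<in> aux_D_feasible A b c d \<alpha> \<beta> \<theta>)
         (q, y1, y2, v1, v2, wD1, wD2)"
    and xtu_def: "(x, t, u) = (1 / (wP1 + wP2)) *\<^sub>R (x1 + x2, p, u1 + u2)"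
    and yzv_def: "(y, z, v) = (1 / (wD1 + wD2)) *\<^sub>R (y1 + y2, q, v1 + v2)"
  shows "wP1 + wP2 \<noteq> 0 \<and> wD1 + wD2 \<noteq> 0 \<and> t \<noteq> 0 \<and>
    (x, t, u) \<in> rel_interior (P_optimal A b c d \<alpha> \<beta>) \<and>
    (y, z, v) \<in> rel_interior (D_optimal A b c d \<alpha> \<beta>) \<and>
    strict_complementary_solution A b c d \<alpha> \<beta> ((1 / t) *\<^sub>R (x, u), (y, z, v))"
proof -
  obtain x0 t0 u0 y0 v0 where P0: "(x0, t0, u0) \<in> P_feasible A b d \<beta>" "P_objective c \<alpha> (x0, t0, u0) = \<theta>"
    and D0: "(y0, \<theta>, v0) \<in> D_feasible A b c d \<alpha> \<beta>"
    and strict0: "\<And>j. 0 < x0 $ j \<or> 0 < v0 $ j" "\<And>i. 0 < u0 $ i \<or> 0 < y0 $ i"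
    using strict_complementary_optimal_pair[OF X_nonempty X_bounded denominator_pos value_P] by metis
  note P_supp = aux_P_support[OF optimal_aux_P P0] and D_supp = aux_D_support[OF optimal_aux_D D0]
  have P: "(x, t, u) \<in> P_feasible A b d \<beta>" "P_objective c \<alpha> (x, t, u) = \<theta>"
    using optimal_aux_P P_supp(1) xtu_def by (auto simp: is_arg_max_def intro: aux_P_normalised)
  have D: "(y, \<theta>, v) \<in> D_feasible A b c d \<alpha> \<beta>" and z: "z = \<theta>"
    using optimal_aux_D D_supp(1) aux_D_normalised[OF _ _ yzv_def] by (auto simp: is_arg_max_def)
  \<comment> \<open>The supports of the normalised points contain those of the strictly
    complementary pair, since the scaling factors are positive.\<close>
  have strict: "0 < x $ j \<or> 0 < v $ j" "0 < u $ i \<or> 0 < y $ i" for i j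
    using strict0(1)[of j] strict0(2)[of i] P_supp(1) P_supp(2)[of j] P_supp(3)[of i] D_supp(1) D_supp(2)[of i]
      D_supp(3)[of j] xtu_def yzv_def by (auto simp: zero_less_divide_iff)
  have t: "0 < t" and \<xi>: "(1 / t) *\<^sub>R x \<in> lfp_feasible A b"
    using P_feasible_pos[OF X_nonempty X_bounded P(1)] .
  have Pf: "A *v x + u = t *\<^sub>R b" "0 \<le> x" "0 \<le> u"
    and Df: "transpose A *v y + \<theta> *\<^sub>R d - v = c" "- (b \<bullet> y) + \<beta> * \<theta> = \<alpha>" "0 \<le> y" "0 \<le> v"
    using P D by (auto simp: P_feasible_def D_feasible_def simp del: transpose_matrix_vector)
  have "(x, t, u) \<in> rel_interior (P_optimal A b c d \<alpha> \<beta>)"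
    unfolding optimal_sets_eq(1)[OF P D]
  proof (rule P_face_rel_interior)
    fix x' :: "real^'n" and t' and u' :: "real^'m"
    assume "(x', t', u') \<in> {s \<in> P_feasible A b d \<beta>. P_objective c \<alpha> s = \<theta>}"
    then have P': "(x', t', u') \<in> P_feasible A b d \<beta>" "P_objective c \<alpha> (x', t', u') = \<theta>"
      by auto
    then have nn: "0 \<le> x'" "0 \<le> u'"
      by (auto simp: P_feasible_def)
    \<comment> \<open>Where a competing optimal \<open>x'\<close> is positive, complementarity gives
      \<open>v $ j = 0\<close>, and strictness makes \<open>x $ j\<close> positive; likewise for
      \<open>u'\<close>, with \<open>y\<close>. Hence the support of \<open>x\<close> and
      \<open>u\<close> is maximal in the face.\<close>
    note slack = complementary_slackness[OF P' D]
    show "0 < x $ j" if "0 < x' $ j" for j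
      using inner_zero_vec[OF nn(1) Df(4) slack(1), of j] strict(1)[of j] that by auto
    show "0 < u $ i" if "0 < u' $ i" for i
      using inner_zero_vec[OF Df(3) nn(2) slack(2), of i] strict(2)[of i] that by auto
  qed (use P t in auto)
  moreover have "(y, z, v) \<in> rel_interior (D_optimal A b c d \<alpha> \<beta>)"
    unfolding optimal_sets_eq(2)[OF P D]
  proof (rule D_face_rel_interior)
    fix y' :: "real^'m" and z' and v' :: "real^'n"
    assume "(y', z', v') \<in> {s \<in> D_feasible A b c d \<alpha> \<beta>. D_objective s = \<theta>}"
    then have D': "(y', \<theta>, v') \<in> D_feasible A b c d \<alpha> \<beta>"
      by (auto simp: D_objective_def)
    then have nn: "0 \<le> y'" "0 \<le> v'"
      by (auto simp: D_feasible_def)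
    \<comment> \<open>The same argument with exchanged roles: competing dual optima are tested
      against the fixed primal point.\<close>
    note slack = complementary_slackness[OF P D']
    show "0 < y $ i" if "0 < y' $ i" for i
      using inner_zero_vec[OF nn(1) Pf(3) slack(2), of i] strict(2)[of i] that by auto
    show "0 < v $ j" if "0 < v' $ j" for j
      using inner_zero_vec[OF Pf(2) nn(2) slack(1), of j] strict(1)[of j] that by auto
  qed (use D z in \<open>auto simp: D_objective_def\<close>)
  moreover have "strict_complementary_solution A b c d \<alpha> \<beta> ((1 / t) *\<^sub>R (x, u), (y, z, v))"
  proof -
    have "u = t *\<^sub>R b - A *v x"
      using Pf(1) by (simp add: algebra_simps)
    \<comment> \<open>Division by \<open>t > 0\<close> undoes the Charnes-Cooper scaling on the
      primal side only; the dual variables are shared by (D) and the fractional dual.\<close>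
    then have u: "(1 / t) *\<^sub>R u = b - A *v ((1 / t) *\<^sub>R x)"
      using t by (simp add: matrix_vector_mult_scaleR scaleR_diff_right)
    have v: "v = transpose A *v y + \<theta> *\<^sub>R d - c"
      using Df(1) by (simp add: algebra_simps del: transpose_matrix_vector)
    have "c \<le> transpose A *v y + \<theta> *\<^sub>R d"
      using Df(4) by (simp add: v less_eq_vec_def del: transpose_matrix_vector)
    then have dual: "(y, \<theta>) \<in> lfp_dual_feasible A b c d \<alpha> \<beta>"
      using Df by (simp add: lfp_dual_feasible_def del: transpose_matrix_vector)
    have slack: "(1 / t) *\<^sub>R x \<bullet> v = 0" "y \<bullet> (1 / t) *\<^sub>R u = 0"
      using complementary_slackness[OF P D] by simp_all
    have "0 < ((1 / t) *\<^sub>R x + v) $ j" for j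
    proof -
      have "0 \<le> x $ j / t" "0 \<le> v $ j"
        using Pf Df t by (auto simp: less_eq_vec_def)
      moreover have "0 < x $ j / t \<or> 0 < v $ j"
        using strict(1)[of j] t by auto
      ultimately show ?thesis
        by auto
    qed
    moreover have "0 < (y + (1 / t) *\<^sub>R u) $ i" for i
    proof -
      have "0 \<le> u $ i / t" "0 \<le> y $ i"
        using Pf Df t by (auto simp: less_eq_vec_def)
      moreover have "0 < u $ i / t \<or> 0 < y $ i"
        using strict(2)[of i] t by auto
      ultimately show ?thesis
        by auto
    qed
    ultimately show ?thesis
      unfolding strict_complementary_solution_def scaleR_Pair split z
      using \<xi> dual u v slack by blast
  qed
  ultimately show ?thesis
    using P_supp(1) D_supp(1) t by auto
qed

end
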